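(* Let $\nu\in M_{\chi_\alpha}(E)$, let $J$ be a nonempty index set, and let $C_j\in\mathcal E$ with $p_j:=\nu(C_j)<\infty$ for $j\in J$. Define $$K_{\nu,C}\bigl((r,j),(s,k)\bigr):=\nu(S_rC_j\cap S_sC_k),\qquad r,s\in G,\ j,k\in J.$$ Then $K_{\nu,C}$ is a finite positive semidefinite kernel on $G\times J$. For all $a,r,s\in G$ and $j,k\in J$ it satisfies $$K_{\nu,C}\bigl((ar,j),(as,k)\bigr)=\chi_\alpha(a)^{-1}K_{\nu,C}\bigl((r,j),(s,k)\bigr),\qquad K_{\nu,C}\bigl((r,j),(r,j)\bigr)=\chi_\alpha(r)^{-1}p_j.$$ If, further, $\mathsf T$ acts on $J$, with the action denoted by $(u,j)\mapsto uj$, $\nu$ is $B$-invariant, and $C_{uj}=B^uC_j$ for all $u\in\mathsf T$, $j\in J$, then $$K_{\nu,C}\bigl((r,uj),(s,uk)\bigr)=K_{\nu,C}\bigl((r,j),(s,k)\bigr)$$ for all $u\in\mathsf T$, $r,s\in G$, $j,k\in J$.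
   Context: Let $q\ge1$ be an integer, $(E,\mathcal E)$ an arbitrary measurable space, and $G=(0,\infty)^q$ with coordinatewise multiplication and its Borel $\sigma$-field. Let $S:G\times E\to E$, $(r,x)\mapsto S_rx$, be a jointly measurable left action: $S_{\boldsymbol 1}x=x$ with $\boldsymbol 1=(1,\ldots,1)$, and $S_r(S_sx)=S_{rs}x$. Fix $\alpha\in(0,\infty)^q$ and put $\chi_\alpha(r)=\prod_{i=1}^q r_i^{\alpha_i}$. A measure $\nu$ on $(E,\mathcal E)$ is $\chi_\alpha$-homogeneous if $\nu(S_rA)=\chi_\alpha(r)^{-1}\nu(A)$ for all $r\in G$, $A\in\mathcal E$. $M_{\chi_\alpha}(E)$ is the set of nonzero $\chi_\alpha$-homogeneous measures $\nu$ for which $0<\nu(A_\star)<\infty$ for some $A_\star\in\mathcal E$ (no $\sigma$-finiteness is assumed). $\mathsf T$ is a locally compact second-countable Hausdorff group, and $B:\mathsf T\times E\to E$, $(a,x)\mapsto B^ax$, is a jointly measurable (left) action with $B^aS_rx=S_rB^ax$ for all $a\in\mathsf T$, $r\in G$, $x\in E$. A measure $\nu$ is $B$-invariant if $(B^a)_\#\nu=\nu$ for every $a\in\mathsf T$, where $(T_\#\nu)(A)=\nu(T^{-1}A)$. A kernel $K$ on a set $X$ is positive semidefinite if $\sum_{\ell,m}c_\ell\overline{c_m}K(z_\ell,z_m)\ge0$ for all finite families $z_\ell\in X$, $c_\ell\in\mathbb C$. *)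

theory Defs
  imports "HOL-Analysis.Analysis" "HOL-Library.Nonpos_Ints" "HOL-Algebra.Group"
begin

text \<open>On \<^typ>\<open>real ^ 'q\<close> the operations \<open>*\<close> and \<open>1\<close> are coordinatewise.\<close>

definition pos_group :: "(real ^ 'q) monoid" where
  "pos_group = \<lparr>carrier = {r. \<forall>i. 0 < r $ i}, mult = (*), one = 1\<rparr>"

definition pos_borel :: "(real ^ 'q) measure" where
  "pos_borel = restrict_space borel (carrier pos_group)"

definition chi :: "real ^ 'q \<Rightarrow> real ^ 'q \<Rightarrow> real" where
  "chi \<alpha> r = (\<Prod>i\<in>UNIV. (r $ i) powr (\<alpha> $ i))"

text \<open>\<open>group_action\<close> of \<open>HOL-Algebra\<close> is not used: it requires each map to be extensional,
  i.e. equal to \<open>undefined\<close> outside \<open>X\<close>.\<close>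

definition left_action :: "('g, 'm) monoid_scheme \<Rightarrow> 'x set \<Rightarrow> ('g \<Rightarrow> 'x \<Rightarrow> 'x) \<Rightarrow> bool" where
  "left_action G X act \<longleftrightarrow>
     (\<forall>g\<in>carrier G. \<forall>x\<in>X. act g x \<in> X) \<and>
     (\<forall>x\<in>X. act \<one>\<^bsub>G\<^esub> x = x) \<and>
     (\<forall>g\<in>carrier G. \<forall>h\<in>carrier G. \<forall>x\<in>X. act g (act h x) = act (g \<otimes>\<^bsub>G\<^esub> h) x)"

text \<open>Of the measures \<open>MG\<close> and \<open>E\<close> only the underlying measurable spaces matter.\<close>

definition measurable_action ::
  "('g, 'm) monoid_scheme \<Rightarrow> 'g measure \<Rightarrow> 'x measure \<Rightarrow> ('g \<Rightarrow> 'x \<Rightarrow> 'x) \<Rightarrow> bool" where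
  "measurable_action G MG E act \<longleftrightarrow>
     left_action G (space E) act \<and> (\<lambda>(g, x). act g x) \<in> MG \<Otimes>\<^sub>M E \<rightarrow>\<^sub>M E"

definition borel_of_topology :: "'a topology \<Rightarrow> 'a measure" where
  "borel_of_topology X = sigma (topspace X) {U. openin X U}"

locale lcsc_hausdorff_group = group T for T :: "('t, 'm) monoid_scheme" (structure) +
  fixes X :: "'t topology"
  assumes topspace_eq: "topspace X = carrier T"
    and continuous_mult: "continuous_map (prod_topology X X) X (\<lambda>(a, b). a \<otimes> b)"
    and continuous_inv: "continuous_map X X (\<lambda>a. inv a)"
    and locally_compact: "locally_compact_space X"
    and second_countable: "second_countable X"
    and Hausdorff: "Hausdorff_space X"

definition homogeneous ::
  "'e measure \<Rightarrow> (real ^ 'q \<Rightarrow> 'e \<Rightarrow> 'e) \<Rightarrow> real ^ 'q \<Rightarrow> 'e measure \<Rightarrow> bool" where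
  "homogeneous E S \<alpha> \<nu> \<longleftrightarrow>
     (\<forall>r\<in>carrier pos_group. \<forall>A\<in>sets E.
        emeasure \<nu> (S r ` A) = ennreal (inverse (chi \<alpha> r)) * emeasure \<nu> A)"

definition homogeneous_measures ::
  "'e measure \<Rightarrow> (real ^ 'q \<Rightarrow> 'e \<Rightarrow> 'e) \<Rightarrow> real ^ 'q \<Rightarrow> 'e measure set" where
  "homogeneous_measures E S \<alpha> =
     {\<nu>. sets \<nu> = sets E \<and> emeasure \<nu> (space E) \<noteq> 0 \<and> homogeneous E S \<alpha> \<nu> \<and>
         (\<exists>A\<in>sets E. 0 < emeasure \<nu> A \<and> emeasure \<nu> A < \<infinity>)}"

definition invariant_measure ::
  "('t, 'm) monoid_scheme \<Rightarrow> 'e measure \<Rightarrow> ('t \<Rightarrow> 'e \<Rightarrow> 'e) \<Rightarrow> 'e measure \<Rightarrow> bool" where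
  "invariant_measure T E B \<nu> \<longleftrightarrow> (\<forall>a\<in>carrier T. distr \<nu> E (B a) = \<nu>)"

text \<open>A complex number lies in \<open>\<real>\<^sub>\<ge>\<^sub>0\<close> iff it is real and nonnegative.\<close>

definition pos_semidef_kernel :: "'x set \<Rightarrow> ('x \<Rightarrow> 'x \<Rightarrow> complex) \<Rightarrow> bool" where
  "pos_semidef_kernel X K \<longleftrightarrow>
     (\<forall>(n::nat) (z :: nat \<Rightarrow> 'x) (c :: nat \<Rightarrow> complex). (\<forall>l<n. z l \<in> X) \<longrightarrow>
        (\<Sum>l<n. \<Sum>m<n. c l * cnj (c m) * K (z l) (z m)) \<in> \<real>\<^sub>\<ge>\<^sub>0)"

definition overlap_kernel ::
  "'e measure \<Rightarrow> (real ^ 'q \<Rightarrow> 'e \<Rightarrow> 'e) \<Rightarrow> ('j \<Rightarrow> 'e set) \<Rightarrow>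
     (real ^ 'q) \<times> 'j \<Rightarrow> (real ^ 'q) \<times> 'j \<Rightarrow> ennreal" where
  "overlap_kernel \<nu> S C = (\<lambda>(r, j) (s, k). emeasure \<nu> (S r ` C j \<inter> S s ` C k))"

end

theory Submission
  imports Defs
begin

text \<open>
  Write \<open>A (r, j) = S r ` C j\<close>, so that \<open>K z w = \<nu> (A z \<inter> A w)\<close>. Since each \<open>S r\<close> is invertible with
  measurable inverse \<open>S (inv r)\<close>, the sets \<open>A z\<close> are measurable, and homogeneity makes their measure
  finite. The kernel is thus the Gram kernel of the indicator functions of the \<open>A z\<close> in \<open>L\<^sup>2(\<nu>)\<close>, and
  \<open>\<Sum>l m. c l * cnj (c m) * \<nu> (A (z l) \<inter> A (z m)) = \<integral>x. \<bar>\<Sum>l. c l * indicator (A (z l)) x\<bar>\<^sup>2 \<partial>\<nu> \<ge> 0\<close>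
  (lemma \<open>pos_semidef_overlap_of_finite_sets\<close>). The integral exists because its integrand is a
  finite combination of indicators of sets of finite measure.

  The two transformation rules have one source: a bijection \<open>f\<close> that carries \<open>A z\<close> to \<open>A z'\<close> and
  \<open>A w\<close> to \<open>A w'\<close> also carries \<open>A z \<inter> A w\<close> to \<open>A z' \<inter> A w'\<close>. For \<open>f = S a\<close> homogeneity then gives the
  factor \<open>1 / chi \<alpha> a\<close>; for \<open>f = B u\<close>, which commutes with every \<open>S r\<close>, invariance gives the factor 1.
\<close>

lemma left_action_inv_cancel:
  assumes "group G" "left_action G X act" "g \<in> carrier G" "x \<in> X"
  shows "act (inv\<^bsub>G\<^esub> g) (act g x) = x" "act g (act (inv\<^bsub>G\<^esub> g) x) = x"
  using assms by (simp_all add: left_action_def group.l_inv group.r_inv)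

lemma left_action_inj_on:
  assumes "group G" "left_action G X act" "g \<in> carrier G"
  shows "inj_on (act g) X"
  by (rule inj_on_inverseI) (rule left_action_inv_cancel(1)[OF assms])

text \<open>A preimage is automatically measurable where a direct image need not be; this is what makes the
  sets \<open>S r ` C j\<close> measurable.\<close>

lemma left_action_image_eq_vimage_inv:
  assumes "group G" "left_action G X act" "g \<in> carrier G" "A \<subseteq> X"
  shows "act g ` A = act (inv\<^bsub>G\<^esub> g) -` A \<inter> X"
proof (intro equalityI subsetI)
  fix y assume "y \<in> act g ` A"
  then show "y \<in> act (inv\<^bsub>G\<^esub> g) -` A \<inter> X"
    using assms left_action_inv_cancel(1)[OF assms(1-3)] by (auto simp: left_action_def)
next
  fix y assume y: "y \<in> act (inv\<^bsub>G\<^esub> g) -` A \<inter> X"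
  then have "y = act g (act (inv\<^bsub>G\<^esub> g) y)"
    using left_action_inv_cancel(2)[OF assms(1-3)] by auto
  with y show "y \<in> act g ` A" by blast
qed

lemma left_action_image_mult:
  assumes "left_action G X act" "g \<in> carrier G" "h \<in> carrier G" "A \<subseteq> X"
  shows "act (g \<otimes>\<^bsub>G\<^esub> h) ` A = act g ` act h ` A"
  using assms unfolding left_action_def image_image by (intro image_cong) auto

lemma measurable_action_section:
  assumes "measurable_action G MG E act" "g \<in> space MG"
  shows "act g \<in> E \<rightarrow>\<^sub>M E"
  using measurable_compose_Pair1[OF assms(2), of "\<lambda>(g, x). act g x" E E] assms(1)
  by (simp add: measurable_action_def)

lemma measurable_action_image_in_sets:
  assumes "group G" "measurable_action G MG E act" "space MG = carrier G"
    and "g \<in> carrier G" "A \<in> sets E"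
  shows "act g ` A \<in> sets E"
proof -
  have "act g ` A = act (inv\<^bsub>G\<^esub> g) -` A \<inter> space E"
    using assms by (intro left_action_image_eq_vimage_inv)
      (auto simp: measurable_action_def dest: sets.sets_into_space)
  moreover have "inv\<^bsub>G\<^esub> g \<in> space MG" using assms by (simp add: group.inv_closed)
  ultimately show ?thesis
    using measurable_sets[OF measurable_action_section[OF assms(2)] assms(5)] by simp
qed

text \<open>Invariance speaks of preimages; applied to the inverse element it gives direct images.\<close>

lemma invariant_measure_image:
  assumes "group G" "measurable_action G MG E act" "space MG = carrier G"
    and "sets \<nu> = sets E" "invariant_measure G E act \<nu>" "g \<in> carrier G" "A \<in> sets E"
  shows "emeasure \<nu> (act g ` A) = emeasure \<nu> A"
proof -
  let ?h = "inv\<^bsub>G\<^esub> g"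
  have h: "?h \<in> carrier G" using assms by (simp add: group.inv_closed)
  have meas: "act ?h \<in> \<nu> \<rightarrow>\<^sub>M E"
    using measurable_action_section[OF assms(2)] h assms(3,4)
    by (simp cong: measurable_cong_sets)
  have "left_action G (space E) act" using assms(2) by (simp add: measurable_action_def)
  then have "act g ` A = act ?h -` A \<inter> space \<nu>"
    unfolding sets_eq_imp_space_eq[OF assms(4)]
    using assms by (intro left_action_image_eq_vimage_inv sets.sets_into_space)
  then have "emeasure \<nu> (act g ` A) = emeasure (distr \<nu> E (act ?h)) A"
    using emeasure_distr[OF meas assms(7)] by simp
  also have "\<dots> = emeasure \<nu> A"
    using assms(5) h by (simp add: invariant_measure_def)
  finally show ?thesis .
qed

lemma group_pos_group: "group (pos_group :: (real ^ 'q) monoid)"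
proof (rule groupI)
  fix x :: "real ^ 'q" assume "x \<in> carrier pos_group"
  then show "\<exists>y\<in>carrier pos_group. y \<otimes>\<^bsub>pos_group\<^esub> x = \<one>\<^bsub>pos_group\<^esub>"
    by (intro bexI[of _ "\<chi> i. inverse (x $ i)"])
      (auto simp: pos_group_def vec_eq_iff less_imp_neq[THEN not_sym])
qed (auto simp: pos_group_def mult.assoc)

lemma space_pos_borel: "space pos_borel = carrier pos_group"
  by (simp add: pos_borel_def space_restrict_space)

lemma space_borel_of_topology: "space (borel_of_topology X) = topspace X"
  unfolding borel_of_topology_def by (rule space_measure_of) (auto dest: openin_subset)

text \<open>The overlap is the inner product of two indicator functions, so the quadratic form is the
  integral of a squared modulus.\<close>

lemma pos_semidef_overlap_of_finite_sets:
  assumes A: "\<And>z. z \<in> Z \<Longrightarrow> A z \<in> fmeasurable M"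
  shows "pos_semidef_kernel Z (\<lambda>z w. complex_of_real (measure M (A z \<inter> A w)))"
  unfolding pos_semidef_kernel_def
proof (intro allI impI)
  fix n :: nat and z :: "nat \<Rightarrow> 'a" and c :: "nat \<Rightarrow> complex"
  assume z: "\<forall>l<n. z l \<in> Z"
  define f where "f x = (\<Sum>l<n. c l * of_real (indicator (A (z l)) x))" for x
  have I: "has_bochner_integral M
      (\<lambda>x. c l * cnj (c m) * of_real (indicator (A (z l) \<inter> A (z m)) x))
      (c l * cnj (c m) * of_real (measure M (A (z l) \<inter> A (z m))))"
    if "l < n" "m < n" for l m
  proof -
    have "A (z l) \<inter> A (z m) \<in> fmeasurable M"
      using A z that by (simp add: fmeasurable.Int)
    then show ?thesis
      by (intro has_bochner_integral_mult_right has_bochner_integral_of_real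
          has_bochner_integral_real_indicator) (auto simp: fmeasurable_def)
  qed
  have expand: "(\<Sum>l<n. \<Sum>m<n. c l * cnj (c m) * of_real (indicator (A (z l) \<inter> A (z m)) x))
      = of_real ((cmod (f x))\<^sup>2)" for x
    unfolding complex_norm_square f_def
    by (simp add: sum_product indicator_inter_arith mult_ac)
  have "has_bochner_integral M (\<lambda>x. complex_of_real ((cmod (f x))\<^sup>2))
      (\<Sum>l<n. \<Sum>m<n. c l * cnj (c m) * of_real (measure M (A (z l) \<inter> A (z m))))"
    unfolding expand[symmetric] by (intro has_bochner_integral_sum I) auto
  then have "(\<Sum>l<n. \<Sum>m<n. c l * cnj (c m) * of_real (measure M (A (z l) \<inter> A (z m))))
      = (\<integral>x. complex_of_real ((cmod (f x))\<^sup>2) \<partial>M)"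
    by (rule has_bochner_integral_integral_eq[symmetric])
  also have "\<dots> = complex_of_real (\<integral>x. (cmod (f x))\<^sup>2 \<partial>M)"
    by (rule integral_complex_of_real)
  finally have "(\<Sum>l<n. \<Sum>m<n. c l * cnj (c m) * of_real (measure M (A (z l) \<inter> A (z m))))
      = complex_of_real (\<integral>x. (cmod (f x))\<^sup>2 \<partial>M)" .
  then show "(\<Sum>l<n. \<Sum>m<n. c l * cnj (c m) * complex_of_real (measure M (A (z l) \<inter> A (z m))))
      \<in> \<real>\<^sub>\<ge>\<^sub>0"
    by simp
qed

theorem lemma4p1:
  fixes E :: "'e measure"
    and S :: "real ^ 'q \<Rightarrow> 'e \<Rightarrow> 'e"
    and \<alpha> :: "real ^ 'q"
    and T :: "('t, 'm) monoid_scheme"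
    and X :: "'t topology"
    and B :: "'t \<Rightarrow> 'e \<Rightarrow> 'e"
    and \<nu> :: "'e measure"
    and J :: "'j set"
    and C :: "'j \<Rightarrow> 'e set"
  defines "G \<equiv> carrier (pos_group :: (real ^ 'q) monoid)"
    and "K \<equiv> overlap_kernel \<nu> S C"
  assumes S: "measurable_action pos_group pos_borel E S"
    and \<alpha>: "\<forall>i. 0 < \<alpha> $ i"
    and T: "lcsc_hausdorff_group T X"
    and B: "measurable_action T (borel_of_topology X) E B"
    and commute: "\<forall>a\<in>carrier T. \<forall>r\<in>G. \<forall>x\<in>space E. B a (S r x) = S r (B a x)"
    and \<nu>: "\<nu> \<in> homogeneous_measures E S \<alpha>"
    and J: "J \<noteq> {}"
    and C: "\<forall>j\<in>J. C j \<in> sets E \<and> emeasure \<nu> (C j) < \<infinity>"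
  shows "(\<forall>z\<in>G \<times> J. \<forall>w\<in>G \<times> J. K z w < \<infinity>) \<and>
    pos_semidef_kernel (G \<times> J) (\<lambda>z w. complex_of_real (enn2real (K z w))) \<and>
    (\<forall>a\<in>G. \<forall>r\<in>G. \<forall>s\<in>G. \<forall>j\<in>J. \<forall>k\<in>J.
       K (a * r, j) (a * s, k) = ennreal (inverse (chi \<alpha> a)) * K (r, j) (s, k)) \<and>
    (\<forall>r\<in>G. \<forall>j\<in>J. K (r, j) (r, j) = ennreal (inverse (chi \<alpha> r)) * emeasure \<nu> (C j)) \<and>
    (\<forall>act. left_action T J act \<longrightarrow> invariant_measure T E B \<nu> \<longrightarrow>
       (\<forall>u\<in>carrier T. \<forall>j\<in>J. C (act u j) = B u ` C j) \<longrightarrow>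
       (\<forall>u\<in>carrier T. \<forall>r\<in>G. \<forall>s\<in>G. \<forall>j\<in>J. \<forall>k\<in>J.
          K (r, act u j) (s, act u k) = K (r, j) (s, k)))"
proof -
  let ?G = "pos_group :: (real ^ 'q) monoid"
  have grpT: "group T" and spT: "space (borel_of_topology X) = carrier T"
    using T by (auto simp: lcsc_hausdorff_group_def lcsc_hausdorff_group_axioms_def
        space_borel_of_topology)
  have actS: "left_action ?G (space E) S" and actB: "left_action T (space E) B"
    using S B by (auto simp: measurable_action_def)
  have sets\<nu>: "sets \<nu> = sets E" and hom: "homogeneous E S \<alpha> \<nu>"
    using \<nu> by (auto simp: homogeneous_measures_def)
  have homD: "emeasure \<nu> (S r ` A) = ennreal (inverse (chi \<alpha> r)) * emeasure \<nu> A"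
    if "r \<in> G" "A \<in> sets E" for r A
    using hom that by (simp add: homogeneous_def G_def)
  have Cs: "C j \<in> sets E" "C j \<subseteq> space E" if "j \<in> J" for j
    using C that sets.sets_into_space by blast+
  have SC: "S r ` C j \<in> sets E" if "r \<in> G" "j \<in> J" for r j
    using measurable_action_image_in_sets[OF group_pos_group S space_pos_borel] that Cs
    by (simp add: G_def)
  have SCf: "S r ` C j \<in> fmeasurable \<nu>" if "r \<in> G" "j \<in> J" for r j
    using SC[OF that] C that homD[OF _ Cs(1)]
    by (intro fmeasurableI) (auto simp: sets\<nu> ennreal_mult_less_top)
  have K: "K (r, j) (s, k) = emeasure \<nu> (S r ` C j \<inter> S s ` C k)" for r s j k
    by (simp add: K_def overlap_kernel_def)

  have finite: "\<forall>z\<in>G \<times> J. \<forall>w\<in>G \<times> J. K z w < \<infinity>"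
    using SCf by (auto simp: K intro!: fmeasurableD2[THEN top.not_eq_extremum[THEN iffD1]]
        fmeasurable.Int)

  have "pos_semidef_kernel (G \<times> J)
      (\<lambda>z w. complex_of_real (measure \<nu> ((\<lambda>(r, j). S r ` C j) z \<inter> (\<lambda>(r, j). S r ` C j) w)))"
    using SCf by (intro pos_semidef_overlap_of_finite_sets) auto
  then have psd: "pos_semidef_kernel (G \<times> J) (\<lambda>z w. complex_of_real (enn2real (K z w)))"
    by (simp add: K_def overlap_kernel_def measure_def case_prod_beta)

  have scale: "K (a * r, j) (a * s, k) = ennreal (inverse (chi \<alpha> a)) * K (r, j) (s, k)"
    if "a \<in> G" "r \<in> G" "s \<in> G" "j \<in> J" "k \<in> J" for a r s j k
  proof -
    have mult: "S (a * t) ` C i = S a ` S t ` C i" if "t \<in> G" "i \<in> J" for t i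
      using left_action_image_mult[OF actS, of a t "C i"] that \<open>a \<in> G\<close> Cs
      by (simp add: G_def) (simp add: pos_group_def)
    have "S a ` (S r ` C j \<inter> S s ` C k) = S a ` S r ` C j \<inter> S a ` S s ` C k"
      using left_action_inj_on[OF group_pos_group actS, of a] that
      by (intro inj_on_image_Int[where C = "space E"] sets.sets_into_space SC) (auto simp: G_def)
    then show ?thesis
      using homD[of a "S r ` C j \<inter> S s ` C k"] SC that by (simp add: K mult sets.Int)
  qed

  have diag: "K (r, j) (r, j) = ennreal (inverse (chi \<alpha> r)) * emeasure \<nu> (C j)"
    if "r \<in> G" "j \<in> J" for r j
    using homD Cs that by (simp add: K)

  have invariant: "K (r, act u j) (s, act u k) = K (r, j) (s, k)"
    if inv: "invariant_measure T E B \<nu>" and CB: "\<forall>u\<in>carrier T. \<forall>j\<in>J. C (act u j) = B u ` C j"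
      and "u \<in> carrier T" "r \<in> G" "s \<in> G" "j \<in> J" "k \<in> J" for act u r s j k
  proof -
    have swap: "S t ` C (act u i) = B u ` S t ` C i" if "t \<in> G" "i \<in> J" for t i
    proof -
      have "S t (B u x) = B u (S t x)" if "x \<in> C i" for x
        using commute \<open>u \<in> carrier T\<close> \<open>t \<in> G\<close> Cs(2)[OF \<open>i \<in> J\<close>] that by force
      then show ?thesis
        using CB \<open>u \<in> carrier T\<close> \<open>i \<in> J\<close> by (simp add: image_image cong: image_cong)
    qed
    have "B u ` (S r ` C j \<inter> S s ` C k) = B u ` S r ` C j \<inter> B u ` S s ` C k"
      using left_action_inj_on[OF grpT actB, of u] that
      by (intro inj_on_image_Int[where C = "space E"] sets.sets_into_space SC) auto
    moreover have "emeasure \<nu> (B u ` (S r ` C j \<inter> S s ` C k)) = emeasure \<nu> (S r ` C j \<inter> S s ` C k)"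
      using invariant_measure_image[OF grpT B spT sets\<nu> inv, of u "S r ` C j \<inter> S s ` C k"] SC that
      by (simp add: sets.Int)
    ultimately show ?thesis
      by (simp only: K swap[OF \<open>r \<in> G\<close> \<open>j \<in> J\<close>] swap[OF \<open>s \<in> G\<close> \<open>k \<in> J\<close>])
  qed

  show ?thesis
    by (intro conjI ballI allI impI finite psd) (auto intro: scale diag invariant)
qed

end
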